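(* Let $H$ be an infinite-dimensional Hilbert space. Then for every $n\in\mathbb{N}$, $n\ge 1$, $$\Theta_H(n)=n^{-1/2},$$ where $\Theta_H(n)$ is the covering index of $H$ at level $n$. In particular, $\Theta_H(2)=\frac{1}{\sqrt2}$.
   Context: Spaces are over $\mathbb{R}$ or $\mathbb{C}$; $B_X$ denotes the closed unit ball of a Banach space $X$. Essential inradius: for a set $A\subset X$, $$\varrho(A)=\sup\{r>0:\ \exists x\in A\ \exists Y\le X \text{ a closed subspace with } \dim X/Y<\infty,\ \dim Y=\infty,\ x+r(B_X\cap Y)\subset A\},$$ with the convention $\sup\varnothing=0$. Covering index: let $\mathcal{C}(X)$ be the family of closed, convex, bounded subsets of $X$. For $n\ge 1$, $$\Theta_X(n)=\inf\Bigl\{\max_{1\le k\le n}\varrho(A_k):\ A_1,\dots,A_n\in\mathcal{C}(X),\ B_X=\bigcup_{k=1}^n A_k\Bigr\}.$$ *)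

theory Defs
  imports "HOL-Analysis.Analysis"
begin

text \<open>The linear-algebraic notions take the scalar multiplication \<open>smul\<close> as an argument, so
  that one definition of the covering index serves real spaces (\<open>smul = scaleR\<close>) and complex
  ones (\<open>smul :: complex \<Rightarrow> _\<close>); "subspace" means subspace over the scalar field at hand.
  Norm, topology, convexity and multiplication by the radius \<open>r\<close> are those of the
  underlying real normed space.\<close>

definition fin_dim :: "('k::field \<Rightarrow> 'a::ab_group_add \<Rightarrow> 'a) \<Rightarrow> 'a set \<Rightarrow> bool" where
  "fin_dim smul Y \<longleftrightarrow> (\<exists>F. finite F \<and> module.span smul F = Y)"

text \<open>\<open>dim X/Y < \<infinity>\<close>: the cosets of finitely many vectors span the quotient.\<close>

definition fin_codim :: "('k::field \<Rightarrow> 'a::ab_group_add \<Rightarrow> 'a) \<Rightarrow> 'a set \<Rightarrow> bool" where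
  "fin_codim smul Y \<longleftrightarrow> (\<exists>F. finite F \<and> module.span smul (Y \<union> F) = UNIV)"

text \<open>The supremum is taken in \<open>[0, \<infinity>]\<close>, where \<open>Sup {} = 0\<close>.\<close>

definition essential_inradius ::
    "('k::field \<Rightarrow> 'a::real_normed_vector \<Rightarrow> 'a) \<Rightarrow> 'a set \<Rightarrow> ennreal" where
  "essential_inradius smul A =
     Sup {ennreal r | r. r > 0 \<and> (\<exists>x\<in>A. \<exists>Y. module.subspace smul Y \<and> closed Y \<and>
            fin_codim smul Y \<and> \<not> fin_dim smul Y \<and>
            (\<lambda>b. x + r *\<^sub>R b) ` (cball 0 1 \<inter> Y) \<subseteq> A)}"

definition covering_index ::
    "('k::field \<Rightarrow> 'a::real_normed_vector \<Rightarrow> 'a) \<Rightarrow> nat \<Rightarrow> ennreal" where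
  "covering_index smul n =
     Inf {Max ((\<lambda>k. essential_inradius smul (A k)) ` {1..n}) | A :: nat \<Rightarrow> 'a set.
            (\<forall>k\<in>{1..n}. closed (A k) \<and> convex (A k) \<and> bounded (A k)) \<and>
            cball 0 1 = (\<Union>k\<in>{1..n}. A k)}"

text \<open>A complex Hilbert space structure on a Banach space: a complex scalar multiplication
  extending the real one, and a sesquilinear form (linear in the first argument) inducing the
  given complete norm. Positive definiteness is part of \<open>ip_self\<close>.\<close>

locale complex_hilbert_space = vector_space smul
  for smul :: "complex \<Rightarrow> 'a::banach \<Rightarrow> 'a" +
  fixes ip :: "'a \<Rightarrow> 'a \<Rightarrow> complex"
  assumes scale_of_real: "smul (complex_of_real r) x = r *\<^sub>R x"
    and ip_add_left: "ip (x + y) z = ip x z + ip y z"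
    and ip_scale_left: "ip (smul c x) y = c * ip x y"
    and ip_cnj: "ip y x = cnj (ip x y)"
    and ip_self: "ip x x = complex_of_real ((norm x)\<^sup>2)"

end

theory Submission
  imports Defs
begin

text \<open>Put \<open>c = 1 / sqrt n\<close>. Upper bound: split an orthonormal sequence into
  \<open>n\<close> infinite classes. By Bessel's inequality every point of the ball has a projection of norm
  at most \<open>c\<close> onto (the span of) one of the classes, so the sets given by these \<open>n\<close>
  conditions cover the ball. Each has essential inradius at most \<open>c\<close>, because a subspace of
  finite codimension meets the span of each class in a unit vector \<open>y\<close>, and \<open>x + r y\<close>,
  \<open>x - r y\<close> both satisfying the condition forces \<open>r \<le> c\<close>.

  Lower bound: suppose that no \<open>A\<^sub>k\<close> contains a ball of radius \<open>c\<close> of a translate of a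
  finite-codimensional subspace. Starting at \<open>0\<close>, leave the piece containing the current point
  \<open>x\<close> by a step \<open>c b\<close>, \<open>norm b \<le> 1\<close>, orthogonal to \<open>x\<close> and to the functionals separating \<open>x\<close>
  from the pieces left before. After \<open>n\<close> steps the point lies in no piece, although its
  squared norm is at most \<open>n c\<^sup>2 = 1\<close>.\<close>

section \<open>Linear algebra of finite codimension\<close>

context vector_space
begin

text \<open>A finite spanning set of \<open>Y\<close>, joined with the finite complement
  \<open>F\<close>, would span the whole space.\<close>

lemma fin_codim_imp_not_fin_dim:
  assumes "fin_codim scale Y" "\<not> fin_dim scale UNIV" "subspace Y"
  shows "\<not> fin_dim scale Y"
proof
  assume "fin_dim scale Y"
  then obtain G where G: "finite G" "span G = Y"
    unfolding fin_dim_def by blast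
  obtain F where F: "finite F" "span (Y \<union> F) = UNIV"
    using assms(1) unfolding fin_codim_def by blast
  have "Y \<union> F \<subseteq> span (G \<union> F)"
    using G(2) span_mono[of G "G \<union> F"] span_superset[of "G \<union> F"] by auto
  then have "span (Y \<union> F) \<subseteq> span (G \<union> F)"
    using span_minimal subspace_span by blast
  then have "span (G \<union> F) = UNIV"
    using F(2) by blast
  then show False
    using assms(2) G(1) F(1) unfolding fin_dim_def by blast
qed

lemma infinite_dim_obtains_nonzero:
  assumes "subspace Y" "\<not> fin_dim scale Y"
  obtains y where "y \<in> Y" "y \<noteq> 0"
proof -
  have "Y \<noteq> {0}"
  proof
    assume "Y = {0}"
    then have "finite {} \<and> span {} = Y"
      by simp
    then show False
      using assms(2) unfolding fin_dim_def by blast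
  qed
  then show thesis
    using subspace_0[OF assms(1)] that by blast
qed

text \<open>Moving one vector \<open>f\<close> from \<open>F\<close> into \<open>Y\<close> enlarges
  \<open>W \<inter> Y\<close> by at most one dimension, so infinite dimension descends to the
  smaller \<open>Y\<close> by induction on \<open>F\<close>. It later provides a nonzero vector of
  \<open>Y\<close> in the span of an infinite orthonormal family.\<close>

lemma infinite_dim_Int_fin_codim:
  assumes "finite F" "subspace W" "\<not> fin_dim scale W" "subspace Y" "W \<subseteq> span (Y \<union> F)"
  shows "\<not> fin_dim scale (W \<inter> Y)"
  using assms(1,4,5)
proof (induction F arbitrary: Y rule: finite_induct)
  case empty
  then have "W \<inter> Y = W"
    using span_minimal[of Y Y] by auto
  then show ?case
    using assms(3) by simp
next
  case (insert f F)
  let ?Y' = "span (insert f Y)"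
  have "Y \<union> insert f F \<subseteq> span (?Y' \<union> F)"
    using span_superset[of "insert f Y"] span_superset[of "?Y' \<union> F"] by blast
  then have "W \<subseteq> span (?Y' \<union> F)"
    using insert.prems(2) span_minimal subspace_span by blast
  then have nf: "\<not> fin_dim scale (W \<inter> ?Y')"
    using insert.IH[of ?Y'] subspace_span by blast
  show ?case
  proof (cases "W \<inter> ?Y' \<subseteq> Y")
    case True
    then have "W \<inter> ?Y' = W \<inter> Y"
      using span_superset[of "insert f Y"] by blast
    then show ?thesis
      using nf by simp
  next
    case False
    then obtain w where w: "w \<in> W" "w \<in> ?Y'" "w \<notin> Y"
      by blast
    have spY: "span Y = Y"
      using insert.prems(1) span_eq_iff by blast
    \<comment> \<open>\<open>a\<close> is the coefficient of \<open>f\<close> in \<open>w\<close>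
      modulo \<open>Y\<close>; it is nonzero because \<open>w \<notin> Y\<close>.\<close>
    obtain a where a: "w - scale a f \<in> Y"
      using span_breakdown_eq[of w f Y] w(2) spY by auto
    have a0: "a \<noteq> 0"
      using a w(3) by auto
    show ?thesis
    proof
      assume "fin_dim scale (W \<inter> Y)"
      then obtain G where G: "finite G" "span G = W \<inter> Y"
        unfolding fin_dim_def by blast
      have "span (insert w G) = W \<inter> ?Y'"
      proof (rule antisym)
        have "G \<subseteq> W \<inter> Y"
          using G(2) span_superset by blast
        then have "insert w G \<subseteq> W \<inter> ?Y'"
          using w span_superset[of "insert f Y"] by blast
        then show "span (insert w G) \<subseteq> W \<inter> ?Y'"
          by (meson assms(2) span_minimal subspace_inter subspace_span)
      next
        show "W \<inter> ?Y' \<subseteq> span (insert w G)"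
        proof
          fix v assume v: "v \<in> W \<inter> ?Y'"
          then obtain b where b: "v - scale b f \<in> Y"
            using span_breakdown_eq[of v f Y] spY by auto
          \<comment> \<open>Subtracting \<open>b / a\<close> times the relation for \<open>w\<close>
            eliminates \<open>f\<close>, so \<open>v\<close> lies in \<open>W \<inter> Y\<close> up
            to a multiple of \<open>w\<close>.\<close>
          have "(v - scale b f) - scale (b / a) (w - scale a f) \<in> Y"
            using a b insert.prems(1) subspace_diff subspace_scale by blast
          moreover have "(v - scale b f) - scale (b / a) (w - scale a f) = v - scale (b / a) w"
            using a0 by (simp add: scale_right_diff_distrib)
          moreover have "v - scale (b / a) w \<in> W"
            using v w(1) assms(2) subspace_diff subspace_scale by blast
          ultimately have "v - scale (b / a) w \<in> span G"
            using G(2) by simp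
          then show "v \<in> span (insert w G)"
            using span_breakdown_eq by blast
        qed
      qed
      then show False
        using nf G(1) unfolding fin_dim_def by (metis finite_insert)
    qed
  qed
qed

end

section \<open>Inner products over the real or complex scalars\<close>

text \<open>\<open>re\<close> is the identity for real scalars and the real part for complex ones, so that
  \<open>re (ip x y)\<close> is the underlying real inner product.\<close>

locale scalar_inner_product = vector_space smul
  for smul :: "'k::real_normed_field \<Rightarrow> 'a::real_normed_vector \<Rightarrow> 'a" +
  fixes ip :: "'a \<Rightarrow> 'a \<Rightarrow> 'k" and re :: "'k \<Rightarrow> real"
  assumes scale_of_real: "smul (of_real r) x = r *\<^sub>R x"
    and ip_add_left: "ip (x + y) z = ip x z + ip y z"
    and ip_scale_left: "ip (smul c x) y = c * ip x y"
    and ip_orth_sym: "ip x y = 0 \<Longrightarrow> ip y x = 0"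
    and ip_self: "ip x x = of_real ((norm x)\<^sup>2)"
    and norm_add_sq: "(norm (x + y))\<^sup>2 = (norm x)\<^sup>2 + 2 * re (ip x y) + (norm y)\<^sup>2"
    and linear_re: "linear re"
    and continuous_ip: "continuous_on UNIV (\<lambda>x. ip x y)"
begin

lemma ip_zero_left [simp]: "ip 0 y = 0"
  using ip_add_left[of 0 0 y] by simp

lemma ip_scaleR_left: "ip (r *\<^sub>R x) y = of_real r * ip x y"
  using ip_scale_left[of "of_real r" x y] by (simp add: scale_of_real)

lemma ip_minus_left: "ip (- x) y = - ip x y"
  using ip_scaleR_left[of "-1" x y] by simp

lemma ip_diff_left: "ip (x - y) z = ip x z - ip y z"
  using ip_add_left[of x "- y" z] by (simp add: ip_minus_left)

lemma ip_sum_left: "ip (sum f F) y = (\<Sum>i\<in>F. ip (f i) y)"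
  by (induction F rule: infinite_finite_induct) (auto simp: ip_add_left)

lemma re_ip_diff_left: "re (ip (x - y) z) = re (ip x z) - re (ip y z)"
  by (simp add: ip_diff_left linear_diff[OF linear_re])

lemma re_ip_scaleR_left: "re (ip (r *\<^sub>R x) z) = r * re (ip x z)"
  using linear_scale[OF linear_re, of r "ip x z"]
  by (simp add: ip_scaleR_left scaleR_conv_of_real)

lemma re_ip_self: "re (ip x x) = (norm x)\<^sup>2"
proof -
  have "(norm (x + x))\<^sup>2 = 4 * (norm x)\<^sup>2"
    by (simp add: scaleR_2[symmetric] power_mult_distrib)
  then show ?thesis
    using norm_add_sq[of x x] by simp
qed

lemma pythagoras:
  assumes "ip x y = 0"
  shows "(norm (x + y))\<^sup>2 = (norm x)\<^sup>2 + (norm y)\<^sup>2"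
  using norm_add_sq[of x y] assms linear_0[OF linear_re] by simp

text \<open>Since \<open>A\<close> is bounded, the vector from an almost nearest point of \<open>A\<close> to \<open>x\<close> already
  separates, so no nearest point, and hence no completeness, is needed.\<close>

lemma separate_point:
  assumes "convex A" "closed A" "bounded A" "A \<noteq> {}" "x \<notin> A"
  shows "\<exists>u. \<forall>z\<in>A. re (ip z u) < re (ip x u)"
proof -
  define d where "d = infdist x A"
  have d: "d > 0"
    using assms infdist_pos_not_in_closed d_def by blast
  obtain M where M: "M > 0" "\<And>z w. z \<in> A \<Longrightarrow> w \<in> A \<Longrightarrow> norm (z - w) \<le> M"
  proof -
    have "z \<in> A \<Longrightarrow> w \<in> A \<Longrightarrow> norm (z - w) \<le> diameter A + 1" for z w
      using diameter_bounded_bound[OF assms(3), of z w] by (simp add: dist_norm)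
    moreover have "diameter A + 1 > 0"
      using diameter_ge_0[OF assms(3)] by simp
    ultimately show thesis
      using that by blast
  qed
  \<comment> \<open>\<open>t \<le> 1\<close> keeps the point at parameter \<open>t\<close> of a
    segment inside \<open>A\<close>; the second bound makes the quadratic errors, divided by
    \<open>t\<close>, at most \<open>d\<^sup>2\<close>.\<close>
  define t where "t = min 1 (d\<^sup>2 / (1 + M\<^sup>2))"
  have t: "0 < t" "t \<le> 1" "t * (1 + M\<^sup>2) \<le> d\<^sup>2"
  proof -
    have p: "0 < 1 + M\<^sup>2"
      by (simp add: add_pos_nonneg)
    show "0 < t" "t \<le> 1"
      using d p by (auto simp: t_def)
    have "t \<le> d\<^sup>2 / (1 + M\<^sup>2)"
      by (simp add: t_def)
    then show "t * (1 + M\<^sup>2) \<le> d\<^sup>2"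
      using p by (simp add: pos_le_divide_eq)
  qed
  \<comment> \<open>The point \<open>a\<close> is nearest up to an excess \<open>t\<^sup>2\<close>
    in squared distance, of the same order as the quadratic term
    \<open>t\<^sup>2 * M\<^sup>2\<close> below.\<close>
  have "d < sqrt (d\<^sup>2 + t\<^sup>2)"
    using t(1) by (intro real_less_rsqrt) auto
  then obtain a where a: "a \<in> A" "dist x a < sqrt (d\<^sup>2 + t\<^sup>2)"
    using cInf_lessD[of "dist x ` A" "sqrt (d\<^sup>2 + t\<^sup>2)"] assms(4)
    by (auto simp: d_def infdist_notempty)
  define u where "u = x - a"
  have u_up: "(norm u)\<^sup>2 < d\<^sup>2 + t\<^sup>2"
    using a(2) unfolding u_def dist_norm
    by (metis abs_of_nonneg norm_ge_zero real_sqrt_abs real_sqrt_less_iff)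
  have low: "d \<le> norm (x - z)" if "z \<in> A" for z
    using infdist_le[OF that, of x] by (simp add: d_def dist_norm)
  have "re (ip z u) < re (ip x u)" if z: "z \<in> A" for z
  proof -
    \<comment> \<open>Moving from \<open>a\<close> towards \<open>z\<close> cannot bring the
      distance to \<open>x\<close> below \<open>d\<close>; expanding the square therefore bounds the
      first-order term.\<close>
    have "a + t *\<^sub>R (z - a) \<in> A"
      using convexD_alt[OF assms(1) a(1) z, of t] t by (simp add: algebra_simps)
    then have "d\<^sup>2 \<le> (norm (x - (a + t *\<^sub>R (z - a))))\<^sup>2"
      using low d by (intro power_mono) auto
    also have "x - (a + t *\<^sub>R (z - a)) = (-t) *\<^sub>R (z - a) + u"
      by (simp add: u_def)
    also have "(norm \<dots>)\<^sup>2 = t\<^sup>2 * (norm (z - a))\<^sup>2 - 2 * t * re (ip (z - a) u) + (norm u)\<^sup>2"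
      unfolding norm_add_sq re_ip_scaleR_left using t(1) by (simp add: power_mult_distrib)
    also have "\<dots> < t\<^sup>2 * M\<^sup>2 - 2 * t * re (ip (z - a) u) + (d\<^sup>2 + t\<^sup>2)"
      using u_up M(2)[OF z a(1)] by (intro add_le_less_mono diff_right_mono mult_left_mono power_mono) auto
    finally have "2 * re (ip (z - a) u) * t < (t * (1 + M\<^sup>2)) * t"
      by (simp add: algebra_simps power2_eq_square)
    then have "2 * re (ip (z - a) u) < t * (1 + M\<^sup>2)"
      using t(1) mult_less_cancel_right_pos by blast
    also have "\<dots> \<le> d\<^sup>2"
      by (rule t(3))
    also have "d\<^sup>2 \<le> (norm u)\<^sup>2"
      using low[OF a(1)] d by (simp add: u_def power_mono)
    finally have "re (ip (z - a) u) < (norm u)\<^sup>2"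
      using zero_le_power2[of "norm u"] by linarith
    also have "\<dots> = re (ip (x - a) u)"
      by (simp add: re_ip_self[symmetric] u_def)
    finally show ?thesis
      by (simp add: re_ip_diff_left)
  qed
  then show ?thesis
    by blast
qed

section \<open>Orthogonal complements of finite sets and the lower bound\<close>

definition orth :: "'a set \<Rightarrow> 'a set" where
  "orth S = {y. \<forall>s\<in>S. ip y s = 0}"

text \<open>In \<open>orth\<close> the varying vector stands in the first argument, where
  \<open>ip\<close> is linear.\<close>

lemma subspace_orth: "subspace (orth S)"
  by (auto simp: subspace_def orth_def ip_add_left ip_scale_left)

lemma closed_orth: "closed (orth S)"
proof -
  have "orth S = (\<Inter>s\<in>S. {y. ip y s = 0})"
    by (auto simp: orth_def)
  moreover have "closed {y. ip y s = 0}" for s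
    using continuous_ip by (intro closed_Collect_eq) auto
  ultimately show ?thesis
    by auto
qed

text \<open>Each further vector \<open>s\<close> cuts \<open>orth S\<close> by the kernel of one
  linear functional, which costs at most one dimension, spanned by \<open>w\<close>.\<close>

lemma fin_codim_orth:
  assumes "finite S"
  shows "fin_codim smul (orth S)"
  using assms
proof (induction S rule: finite_induct)
  case empty
  show ?case
    unfolding fin_codim_def orth_def by (intro exI[of _ "{}"]) auto
next
  case (insert s S)
  then obtain F where F: "finite F" "span (orth S \<union> F) = UNIV"
    unfolding fin_codim_def by blast
  obtain w where w: "orth S \<subseteq> span (insert w (orth (insert s S)))"
  proof (cases "orth S \<subseteq> orth (insert s S)")
    case True
    \<comment> \<open>The functional of \<open>s\<close> vanishes on \<open>orth S\<close>, so no
      dimension is lost and \<open>0\<close> serves as \<open>w\<close>.\<close>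
    then show thesis
      using that[of 0] span_superset[of "insert 0 (orth (insert s S))"] by blast
  next
    case False
    then obtain w where w: "w \<in> orth S" "ip w s \<noteq> 0"
      by (auto simp: orth_def)
    have "v \<in> span (insert w (orth (insert s S)))" if "v \<in> orth S" for v
    proof -
      have "v - smul (ip v s / ip w s) w \<in> orth (insert s S)"
        using that w by (auto simp: orth_def ip_diff_left ip_scale_left)
      then show ?thesis
        using span_breakdown_eq span_base by blast
    qed
    then show thesis
      using that by blast
  qed
  let ?Z = "orth (insert s S) \<union> insert w F"
  have "insert w (orth (insert s S)) \<subseteq> ?Z"
    by blast
  then have "orth S \<union> F \<subseteq> span ?Z"
    using w span_mono[of "insert w (orth (insert s S))" ?Z] span_superset[of ?Z] by blast
  then have "span (orth S \<union> F) \<subseteq> span ?Z"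
    using span_minimal subspace_span by blast
  then show ?case
    using F unfolding fin_codim_def by (intro exI[of _ "insert w F"]) auto
qed

text \<open>Used in contrapositive form: a piece of essential inradius below \<open>c\<close> can be
  left from any of its points by a step \<open>c *\<^sub>R b\<close>, \<open>norm b \<le> 1\<close>,
  orthogonal to any prescribed finite set.\<close>

lemma le_essential_inradius:
  assumes "0 < c" "x \<in> A" "finite S" "\<not> fin_dim smul (UNIV :: 'a set)"
    and "\<And>b. b \<in> orth S \<Longrightarrow> norm b \<le> 1 \<Longrightarrow> x + c *\<^sub>R b \<in> A"
  shows "ennreal c \<le> essential_inradius smul A"
proof -
  have "subspace (orth S)" "closed (orth S)" "fin_codim smul (orth S)" "\<not> fin_dim smul (orth S)"
    using subspace_orth closed_orth fin_codim_orth assms(3,4) fin_codim_imp_not_fin_dim by blast+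
  moreover have "(\<lambda>b. x + c *\<^sub>R b) ` (cball 0 1 \<inter> orth S) \<subseteq> A"
    using assms(5) by auto
  ultimately show ?thesis
    unfolding essential_inradius_def using assms(1,2) by (intro Sup_upper) blast
qed

lemma covering_has_large_piece:
  assumes inf: "\<not> fin_dim smul (UNIV :: 'a set)"
    and A: "\<And>k. k \<in> {1..n} \<Longrightarrow> closed (A k) \<and> convex (A k) \<and> bounded (A k)"
    and cover: "cball 0 1 = (\<Union>k\<in>{1..n}. A k)"
    and c: "0 < c" "real n * c\<^sup>2 \<le> 1"
  shows "\<exists>k\<in>{1..n}. ennreal c \<le> essential_inradius smul (A k)"
proof (rule ccontr)
  assume neg: "\<not> ?thesis"
  \<comment> \<open>Points reached after at most \<open>n\<close> steps are still in the unit ball,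
    hence covered.\<close>
  have in_piece: "\<exists>k\<in>{1..n}. x \<in> A k" if "(norm x)\<^sup>2 \<le> real j * c\<^sup>2" "j \<le> n" for x j
  proof -
    have "(norm x)\<^sup>2 \<le> real n * c\<^sup>2"
      using that by (meson mult_right_mono of_nat_le_iff order_trans zero_le_power2)
    then have "norm x \<le> 1"
      using c(2) abs_square_le_1[of "norm x"] by simp
    then show ?thesis
      using cover by (metis UN_E mem_cball_0)
  qed
  \<comment> \<open>Invariant after \<open>j\<close> steps: \<open>D\<close> collects the pieces
    already left, and for \<open>k \<in> D\<close> the functional of \<open>u k\<close> strictly
    separates the current point from \<open>A k\<close>.\<close>
  have "\<exists>x D u. D \<subseteq> {1..n} \<and> card D = j \<and> (norm x)\<^sup>2 \<le> real j * c\<^sup>2 \<and>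
          (\<forall>k\<in>D. \<forall>z\<in>A k. re (ip z (u k)) < re (ip x (u k)))" if "j \<le> n" for j
    using that
  proof (induction j)
    case 0
    show ?case
      by (intro exI[of _ 0] exI[of _ "{}"]) auto
  next
    case (Suc j)
    then obtain x D u where D: "D \<subseteq> {1..n}" "card D = j" and x: "(norm x)\<^sup>2 \<le> real j * c\<^sup>2"
      and u: "\<And>k z. k \<in> D \<Longrightarrow> z \<in> A k \<Longrightarrow> re (ip z (u k)) < re (ip x (u k))"
      by (meson Suc_leD)
    have fD: "finite D"
      using D(1) finite_subset by blast
    obtain k where k: "k \<in> {1..n}" "x \<in> A k"
      using in_piece[OF x] Suc.prems by auto
    \<comment> \<open>For \<open>k \<in> D\<close> the point \<open>x\<close> would satisfy the
      strict inequality against itself.\<close>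
    have kD: "k \<notin> D"
      using u k(2) by blast
    \<comment> \<open>Orthogonality to \<open>x\<close> makes squared norms add; orthogonality to
      the old \<open>u i\<close> leaves their values at the point, and so the old separations,
      unchanged.\<close>
    let ?S = "insert x (u ` D)"
    have "\<exists>b\<in>orth ?S. norm b \<le> 1 \<and> x + c *\<^sub>R b \<notin> A k"
    proof (rule ccontr)
      assume "\<not> ?thesis"
      then have "ennreal c \<le> essential_inradius smul (A k)"
        using fD by (intro le_essential_inradius[OF c(1) k(2) _ inf, of ?S]) auto
      then show False
        using neg k(1) by blast
    qed
    then obtain b where b: "b \<in> orth ?S" "norm b \<le> 1" "x + c *\<^sub>R b \<notin> A k"
      by blast
    define x' where "x' = x + c *\<^sub>R b"
    obtain v where v: "\<And>z. z \<in> A k \<Longrightarrow> re (ip z v) < re (ip x' v)"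
      using separate_point[of "A k" x'] A[OF k(1)] k(2) b(3) x'_def by auto
    have "ip (c *\<^sub>R b) x = 0"
      using b(1) by (simp add: orth_def ip_scaleR_left)
    then have "ip x (c *\<^sub>R b) = 0"
      by (rule ip_orth_sym)
    then have "(norm x')\<^sup>2 = (norm x)\<^sup>2 + c\<^sup>2 * (norm b)\<^sup>2"
      using pythagoras[of x "c *\<^sub>R b"] by (simp add: x'_def power_mult_distrib)
    also have "\<dots> \<le> real j * c\<^sup>2 + c\<^sup>2 * 1"
      using x b(2) by (intro add_mono mult_left_mono) (auto simp: power_le_one)
    finally have x': "(norm x')\<^sup>2 \<le> real (Suc j) * c\<^sup>2"
      by (simp add: algebra_simps)
    have "re (ip z ((u(k := v)) i)) < re (ip x' ((u(k := v)) i))"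
      if "i \<in> insert k D" "z \<in> A i" for i z
    proof (cases "i = k")
      case True
      then show ?thesis
        using v that(2) by simp
    next
      case False
      then have "ip (c *\<^sub>R b) (u i) = 0"
        using b(1) that(1) by (simp add: orth_def ip_scaleR_left)
      then have "ip x' (u i) = ip x (u i)"
        by (simp add: x'_def ip_add_left)
      then show ?thesis
        using False u that by auto
    qed
    moreover have "insert k D \<subseteq> {1..n}" "card (insert k D) = Suc j"
      using D k(1) kD fD by auto
    ultimately show ?case
      using x' by blast
  qed
  then obtain x D u where D: "D \<subseteq> {1..n}" "card D = n" and x: "(norm x)\<^sup>2 \<le> real n * c\<^sup>2"
      and u: "\<forall>k\<in>D. \<forall>z\<in>A k. re (ip z (u k)) < re (ip x (u k))"
    using order_refl[of n] by meson
  have "D = {1..n}"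
    using D by (intro card_subset_eq) auto
  then show False
    using in_piece[OF x] u by blast
qed

section \<open>Orthonormal sequences, projections and slabs\<close>

definition orthonormal_seq :: "(nat \<Rightarrow> 'a) \<Rightarrow> bool" where
  "orthonormal_seq e \<longleftrightarrow> (\<forall>i j. ip (e i) (e j) = (if i = j then 1 else 0))"

text \<open>The complement of the finitely many vectors chosen so far is infinite-dimensional, so it
  contains a nonzero vector, which is normalised.\<close>

lemma exists_orthonormal_seq:
  assumes "\<not> fin_dim smul (UNIV :: 'a set)"
  obtains e where "orthonormal_seq e"
proof -
  have "\<exists>e :: nat \<Rightarrow> 'a. \<forall>i. norm (e i) = 1 \<and> e i \<in> orth (e ` {..<i})"
  proof (rule dependent_wellorder_choice)
    fix i :: nat and f :: "nat \<Rightarrow> 'a"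
    have "\<not> fin_dim smul (orth (f ` {..<i}))"
      using assms fin_codim_orth fin_codim_imp_not_fin_dim subspace_orth by blast
    then obtain y where y: "y \<in> orth (f ` {..<i})" "y \<noteq> 0"
      by (rule infinite_dim_obtains_nonzero[OF subspace_orth])
    have "(1 / norm y) *\<^sub>R y \<in> orth (f ` {..<i})"
      using y(1) by (simp add: orth_def ip_scaleR_left)
    moreover have "norm ((1 / norm y) *\<^sub>R y) = 1"
      using y(2) by simp
    ultimately show "\<exists>v. norm v = 1 \<and> v \<in> orth (f ` {..<i})"
      by blast
  qed (auto simp: orth_def)
  then obtain e :: "nat \<Rightarrow> 'a" where e: "\<And>i. norm (e i) = 1" "\<And>i. e i \<in> orth (e ` {..<i})"
    by blast
  have "ip (e i) (e j) = 0" if "i \<noteq> j" for i j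
  proof (cases "j < i")
    case True
    then show ?thesis
      using e(2)[of i] by (auto simp: orth_def)
  next
    case False
    then have "ip (e j) (e i) = 0"
      using e(2)[of j] that by (auto simp: orth_def)
    then show ?thesis
      by (rule ip_orth_sym)
  qed
  then have "orthonormal_seq e"
    by (simp add: orthonormal_seq_def ip_self e(1))
  then show thesis
    by (rule that)
qed

text \<open>For orthonormal \<open>e\<close> and finite \<open>F\<close> this is the orthogonal
  projection onto the span of the \<open>e i\<close> with \<open>i \<in> F\<close>. For infinite
  \<open>F\<close> the sum defaults to \<open>0\<close>.\<close>

definition proj :: "(nat \<Rightarrow> 'a) \<Rightarrow> nat set \<Rightarrow> 'a \<Rightarrow> 'a" where
  "proj e F x = (\<Sum>i\<in>F. smul (ip x (e i)) (e i))"

lemma linear_proj: "linear (proj e F)"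
proof (rule linearI)
  show "proj e F (x + y) = proj e F x + proj e F y" for x y
    by (simp add: proj_def ip_add_left scale_left_distrib sum.distrib)
  show "proj e F (r *\<^sub>R x) = r *\<^sub>R proj e F x" for r x
    by (simp add: proj_def ip_scaleR_left scale_of_real[symmetric] scale_sum_right ip_scale_left)
qed

text \<open>For orthonormal \<open>e\<close> and \<open>0 \<le> c\<close>, the finite sets
  \<open>F\<close> express that the squared coefficients of \<open>x\<close> over \<open>C\<close>
  sum to at most \<open>c\<^sup>2\<close>, without infinite sums.\<close>

definition slab :: "(nat \<Rightarrow> 'a) \<Rightarrow> real \<Rightarrow> nat set \<Rightarrow> 'a set" where
  "slab e c C = {x. norm x \<le> 1 \<and> (\<forall>F. finite F \<longrightarrow> F \<subseteq> C \<longrightarrow> norm (proj e F x) \<le> c)}"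

text \<open>Convexity, boundedness and closedness are read off from this form.\<close>

lemma slab_eq_Int:
  "slab e c C = cball 0 1 \<inter> (\<Inter>F\<in>{F. finite F \<and> F \<subseteq> C}. proj e F -` cball 0 c)"
  by (simp add: slab_def set_eq_iff imp_conjL)

lemma convex_slab: "convex (slab e c C)"
proof -
  have "convex (proj e F -` cball 0 c)" for F
    by (rule convex_linear_vimage[OF linear_proj convex_cball])
  then show ?thesis
    unfolding slab_eq_Int by (intro convex_Int convex_cball convex_INT)
qed

lemma bounded_slab: "bounded (slab e c C)"
  using bounded_subset[OF bounded_cball] unfolding slab_eq_Int by blast

section \<open>Upper bound: slabs of an orthonormal sequence\<close>

context
  fixes e :: "nat \<Rightarrow> 'a"
  assumes orthonormal: "orthonormal_seq e"
begin

lemma ip_e: "ip (e i) (e j) = (if i = j then 1 else 0)"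
  using orthonormal by (simp add: orthonormal_seq_def)

lemma ip_proj_e:
  assumes "finite F"
  shows "ip (proj e F x) (e j) = (if j \<in> F then ip x (e j) else 0)"
  using assms by (simp add: proj_def ip_sum_left ip_scale_left ip_e if_distrib cong: if_cong)

text \<open>Symmetry of orthogonality moves the sum into the first argument, where \<open>ip\<close>
  is linear.\<close>

lemma ip_proj_right_eq_0:
  assumes "\<And>i. i \<in> F \<Longrightarrow> ip y (e i) = 0"
  shows "ip y (proj e F x) = 0"
proof (rule ip_orth_sym)
  show "ip (proj e F x) y = 0"
    using assms ip_orth_sym by (simp add: proj_def ip_sum_left ip_scale_left)
qed

text \<open>Bessel's inequality: \<open>x - proj e F x\<close> is orthogonal to
  \<open>proj e F x\<close>.\<close>

lemma norm_proj_le: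
  assumes "finite F"
  shows "norm (proj e F x) \<le> norm x"
proof -
  have "ip (x - proj e F x) (proj e F x) = 0"
    using assms by (intro ip_proj_right_eq_0) (simp add: ip_diff_left ip_proj_e)
  from pythagoras[OF this] have "(norm (proj e F x))\<^sup>2 \<le> (norm x)\<^sup>2"
    by simp
  then show ?thesis
    by (simp add: power_mono_iff abs_le_square_iff[symmetric])
qed

lemma norm_proj_Un_sq:
  assumes "finite F" "finite G" "F \<inter> G = {}"
  shows "(norm (proj e (F \<union> G) x))\<^sup>2 = (norm (proj e F x))\<^sup>2 + (norm (proj e G x))\<^sup>2"
proof -
  have "ip (proj e F x) (proj e G x) = 0"
    using assms by (intro ip_proj_right_eq_0) (auto simp: ip_proj_e)
  moreover have "proj e (F \<union> G) x = proj e F x + proj e G x"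
    using assms by (simp add: proj_def sum.union_disjoint)
  ultimately show ?thesis
    using pythagoras by simp
qed

lemma norm_proj_UN_sq:
  assumes "finite K" "\<And>k. k \<in> K \<Longrightarrow> finite (F k)"
    and "\<And>k l. k \<in> K \<Longrightarrow> l \<in> K \<Longrightarrow> k \<noteq> l \<Longrightarrow> F k \<inter> F l = {}"
  shows "(norm (proj e (\<Union>k\<in>K. F k) x))\<^sup>2 = (\<Sum>k\<in>K. (norm (proj e (F k) x))\<^sup>2)"
  using assms
proof (induction K rule: finite_induct)
  case empty
  show ?case
    by (simp add: proj_def)
next
  case (insert k K)
  have "F k \<inter> (\<Union>l\<in>K. F l) = {}"
    using insert.hyps(2) insert.prems(2)[of k] by fastforce
  then have "(norm (proj e (F k \<union> (\<Union>l\<in>K. F l)) x))\<^sup>2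
      = (norm (proj e (F k) x))\<^sup>2 + (norm (proj e (\<Union>l\<in>K. F l) x))\<^sup>2"
    using insert.prems(1) insert.hyps(1) by (intro norm_proj_Un_sq) auto
  then show ?case
    using insert by simp
qed

lemma proj_eq_self:
  assumes "finite F" "y \<in> span (e ` F)"
  shows "proj e F y = y"
  using assms(2)
proof (induction rule: span_induct_alt)
  case base
  show ?case
    by (simp add: proj_def)
next
  case (step c v y)
  then obtain j where j: "j \<in> F" "v = e j"
    by blast
  have "proj e F (smul c (e j)) = (\<Sum>i\<in>F. if i = j then smul c (e j) else 0)"
    unfolding proj_def by (intro sum.cong) (auto simp: ip_scale_left ip_e)
  also have "\<dots> = smul c (e j)"
    using assms(1) j(1) by simp
  finally show ?case
    using step j(2) linear_add[OF linear_proj] by simp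
qed

lemma inj_e: "inj e"
  by (rule injI) (metis ip_e zero_neq_one)

text \<open>Each \<open>e j\<close> is orthogonal to the span of the others but not to itself, so
  the family is independent; an independent set inside a finitely generated span is finite.\<close>

lemma not_fin_dim_span:
  assumes "infinite C"
  shows "\<not> fin_dim smul (span (e ` C))"
proof
  assume "fin_dim smul (span (e ` C))"
  then obtain G where G: "finite G" "span G = span (e ` C)"
    unfolding fin_dim_def by blast
  have "independent (e ` C)"
    unfolding dependent_def
  proof clarify
    fix j assume j: "j \<in> C" "e j \<in> span (e ` C - {e j})"
    have "e ` C - {e j} \<subseteq> orth {e j}"
      by (auto simp: orth_def ip_e)
    then have "e j \<in> orth {e j}"
      using j(2) span_minimal subspace_orth by blast
    then show False
      by (simp add: orth_def ip_e)
  qed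
  moreover have "e ` C \<subseteq> span G"
    unfolding G(2) by (rule span_superset)
  ultimately have "finite (e ` C)"
    using independent_span_bound[OF G(1)] by simp
  then show False
    using assms finite_imageD[OF _ inj_on_subset[OF inj_e subset_UNIV]] by simp
qed

lemma closed_slab: "closed (slab e c C)"
proof -
  have "continuous_on UNIV (proj e F)" if "finite F" for F
  proof -
    have "bounded_linear (proj e F)"
    proof (rule bounded_linear_intro[where K = 1])
      show "proj e F (x + y) = proj e F x + proj e F y" for x y
        by (rule linear_add[OF linear_proj])
      show "proj e F (r *\<^sub>R x) = r *\<^sub>R proj e F x" for r x
        by (rule linear_scale[OF linear_proj])
      show "norm (proj e F x) \<le> norm x * 1" for x
        using norm_proj_le[OF that] by simp
    qed
    then show ?thesis
      by (simp add: linear_continuous_on)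
  qed
  then show ?thesis
    unfolding slab_eq_Int
    using closed_vimage[OF closed_cball] by (intro closed_Int closed_cball closed_INT) blast
qed

lemma essential_inradius_slab_le:
  assumes "infinite C"
  shows "essential_inradius smul (slab e c C) \<le> ennreal c"
  unfolding essential_inradius_def
proof (rule Sup_least, clarify)
  fix r :: real and x Y
  assume r: "r > 0" and Y: "subspace Y" "fin_codim smul Y"
    and sub: "(\<lambda>b. x + r *\<^sub>R b) ` (cball 0 1 \<inter> Y) \<subseteq> slab e c C"
  obtain G where G: "finite G" "span (Y \<union> G) = UNIV"
    using Y(2) unfolding fin_codim_def by blast
  have "\<not> fin_dim smul (span (e ` C) \<inter> Y)"
    using infinite_dim_Int_fin_codim[OF G(1) subspace_span not_fin_dim_span[OF assms] Y(1)] G(2)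
    by simp
  then obtain y where y: "y \<in> span (e ` C)" "y \<in> Y" "y \<noteq> 0"
    using infinite_dim_obtains_nonzero[OF subspace_inter[OF subspace_span Y(1)]] by (metis IntE)
  \<comment> \<open>Only finitely many \<open>e i\<close> enter \<open>y\<close>, so some finite
    \<open>F \<subseteq> C\<close> has a projection fixing \<open>y\<close>; the slab condition for
    this \<open>F\<close> sees \<open>y\<close> at full length.\<close>
  obtain t where t: "finite t" "t \<subseteq> e ` C" "y \<in> span t"
  proof -
    obtain t g where t: "finite t" "t \<subseteq> e ` C" "y = (\<Sum>a\<in>t. smul (g a) a)"
      using y(1) unfolding span_explicit by blast
    have "y \<in> span t"
      unfolding t(3) by (intro span_sum span_scale span_base)
    with t(1,2) show thesis
      by (rule that)
  qed
  obtain F where F: "finite F" "F \<subseteq> C" "t = e ` F"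
    using finite_subset_image[OF t(1,2)] by blast
  define b where "b = (1 / norm y) *\<^sub>R y"
  have b: "b \<in> Y" "- b \<in> Y" "norm b = 1"
    using y subspace_scale[OF Y(1), of y "of_real (1 / norm y)"] subspace_neg[OF Y(1)]
    unfolding scale_of_real b_def by auto
  have "proj e F b = b"
    using proj_eq_self[of F y] F t(3) linear_scale[OF linear_proj] by (simp add: b_def)
  then have pr: "proj e F (x + s *\<^sub>R b) = proj e F x + s *\<^sub>R b" for s
    using linear_add[OF linear_proj] linear_scale[OF linear_proj] by simp
  have "x + r *\<^sub>R b \<in> slab e c C" "x + r *\<^sub>R (- b) \<in> slab e c C"
    using b by (auto simp del: scaleR_minus_right intro!: subsetD[OF sub] imageI)
  then have "x + r *\<^sub>R b \<in> slab e c C" "x + (- r) *\<^sub>R b \<in> slab e c C"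
    by auto
  then have "norm (proj e F (x + r *\<^sub>R b)) \<le> c" "norm (proj e F (x + (- r) *\<^sub>R b)) \<le> c"
    using F(1,2) unfolding slab_def by blast+
  then have "norm (proj e F x + r *\<^sub>R b) \<le> c" "norm (proj e F x + (- r) *\<^sub>R b) \<le> c"
    by (simp_all only: pr)
  \<comment> \<open>The two projected points have norm at most \<open>c\<close> and differ by a
    vector of length \<open>2 * r\<close>.\<close>
  then have "norm ((proj e F x + r *\<^sub>R b) - (proj e F x + (- r) *\<^sub>R b)) \<le> 2 * c"
    by (intro order_trans[OF norm_triangle_ineq4]) auto
  moreover have "(proj e F x + r *\<^sub>R b) - (proj e F x + (- r) *\<^sub>R b) = (2 * r) *\<^sub>R b"
    by (simp add: scaleR_2[symmetric])
  ultimately show "ennreal r \<le> ennreal c"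
    using r b(3) by (intro ennreal_leI) simp
qed

text \<open>A point outside all slabs has disjoint finite witnesses \<open>F k\<close> with
  projections longer than \<open>c\<close>. Their squares sum to more than
  \<open>card K * c\<^sup>2 \<ge> 1\<close>, against Bessel's inequality for the union.\<close>

lemma cball_subset_UN_slab:
  assumes "finite K" "K \<noteq> {}" "disjoint_family_on C K" "1 \<le> real (card K) * c\<^sup>2" "0 \<le> c"
  shows "cball 0 1 \<subseteq> (\<Union>k\<in>K. slab e c (C k))"
proof (rule ccontr)
  assume "\<not> ?thesis"
  then obtain x where x: "norm x \<le> 1" "\<And>k. k \<in> K \<Longrightarrow> x \<notin> slab e c (C k)"
    by (auto simp: subset_iff)
  then have "\<forall>k\<in>K. \<exists>F. finite F \<and> F \<subseteq> C k \<and> c < norm (proj e F x)"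
    by (auto simp: slab_def not_le)
  then obtain F where F: "\<And>k. k \<in> K \<Longrightarrow> finite (F k)" "\<And>k. k \<in> K \<Longrightarrow> F k \<subseteq> C k"
      "\<And>k. k \<in> K \<Longrightarrow> c < norm (proj e (F k) x)"
    by metis
  have disj: "F k \<inter> F l = {}" if "k \<in> K" "l \<in> K" "k \<noteq> l" for k l
    using F(2) that assms(3) unfolding disjoint_family_on_def by blast
  have "1 \<le> (\<Sum>k\<in>K. c\<^sup>2)"
    using assms(4) by simp
  also have "\<dots> < (\<Sum>k\<in>K. (norm (proj e (F k) x))\<^sup>2)"
    using F(3) assms by (intro sum_strict_mono power_strict_mono) auto
  also have "\<dots> = (norm (proj e (\<Union>k\<in>K. F k) x))\<^sup>2"
    using norm_proj_UN_sq[OF assms(1) F(1) disj] by simp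
  also have "\<dots> \<le> (norm x)\<^sup>2"
    using norm_proj_le assms(1) F(1) by (intro power_mono) auto
  also have "\<dots> \<le> 1"
    using x(1) by (simp add: power_le_one)
  finally show False
    by simp
qed

end

section \<open>The value of the covering index\<close>

theorem covering_index_eq:
  assumes inf: "\<not> fin_dim smul (UNIV :: 'a set)" and n: "1 \<le> n"
  shows "covering_index smul n = ennreal (real n powr (-1/2))"
proof (rule antisym)
  define c where "c = real n powr (-1/2)"
  have c: "0 < c" "real n * c\<^sup>2 = 1"
  proof -
    show "0 < c"
      using n by (simp add: c_def)
    have "c\<^sup>2 = real n powr (-1)"
      by (simp add: c_def power2_eq_square powr_add[symmetric])
    then show "real n * c\<^sup>2 = 1"
      using n by (simp add: powr_minus_divide)
  qed
  obtain e where e: "orthonormal_seq e"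
    by (rule exists_orthonormal_seq[OF inf])
  \<comment> \<open>Residue classes modulo \<open>n\<close> are infinite and disjoint; the shift
    \<open>k - 1\<close> matches the pieces \<open>1..n\<close> with the residues
    \<open>0..n-1\<close>.\<close>
  define C where "C k = {i. i mod n = k - 1}" for k
  have C_inf: "infinite (C k)" if "k \<in> {1..n}" for k
  proof -
    define j where "j = k - 1"
    have "k = Suc j" "j < n"
      using that by (auto simp: j_def)
    then have "range (\<lambda>m. m * n + (k - 1)) \<subseteq> C k"
      by (auto simp: C_def)
    moreover have "inj (\<lambda>m. m * n + (k - 1))"
      using n by (auto simp: inj_def)
    ultimately show ?thesis
      using finite_subset range_inj_infinite by blast
  qed
  have "disjoint_family_on C {1..n}"
    by (auto simp: disjoint_family_on_def C_def)
  then have "cball 0 1 \<subseteq> (\<Union>k\<in>{1..n}. slab e c (C k))"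
    using n c by (intro cball_subset_UN_slab[OF e]) auto
  then have cov: "cball 0 1 = (\<Union>k\<in>{1..n}. slab e c (C k))"
    by (auto simp: slab_def)
  let ?M = "Max ((\<lambda>k. essential_inradius smul (slab e c (C k))) ` {1..n})"
  have "covering_index smul n \<le> ?M"
    unfolding covering_index_def
    by (intro Inf_lower CollectI exI[of _ "\<lambda>k. slab e c (C k)"] conjI refl ballI
        closed_slab[OF e] convex_slab bounded_slab cov)
  also have "\<dots> \<le> ennreal c"
    using n essential_inradius_slab_le[OF e C_inf] by (subst Max_le_iff) auto
  finally show "covering_index smul n \<le> ennreal (real n powr (-1/2))"
    by (simp add: c_def)
  have "ennreal c \<le> covering_index smul n"
    unfolding covering_index_def
  proof (rule Inf_greatest, clarify)
    fix A :: "nat \<Rightarrow> 'a set"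
    assume "\<forall>k\<in>{1..n}. closed (A k) \<and> convex (A k) \<and> bounded (A k)"
      and "cball 0 1 = (\<Union>k\<in>{1..n}. A k)"
    then obtain k where "k \<in> {1..n}" "ennreal c \<le> essential_inradius smul (A k)"
      using covering_has_large_piece[OF inf, of n A c] c by auto
    then show "ennreal c \<le> Max ((\<lambda>k. essential_inradius smul (A k)) ` {1..n})"
      by (subst Max_ge_iff) auto
  qed
  then show "ennreal (real n powr (-1/2)) \<le> covering_index smul n"
    by (simp add: c_def)
qed

end

section \<open>Real and complex Hilbert spaces\<close>

lemma scalar_inner_product_real:
  "scalar_inner_product (scaleR :: real \<Rightarrow> 'r::real_inner \<Rightarrow> 'r) inner (\<lambda>r. r)"
proof (intro scalar_inner_product.intro scalar_inner_product_axioms.intro)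
  show "vector_space (scaleR :: real \<Rightarrow> 'r \<Rightarrow> 'r)"
    by (rule real_vector.vector_space_axioms)
  show "linear (\<lambda>r::real. r)"
    by (rule linear_ident)
  show "(norm (x + y))\<^sup>2 = (norm x)\<^sup>2 + 2 * inner x y + (norm y)\<^sup>2" for x y :: 'r
    by (simp add: power2_norm_eq_inner inner_add_left inner_add_right inner_commute)
  show "continuous_on UNIV (\<lambda>x. inner x y)" for y :: 'r
    by (intro continuous_intros)
  show "inner y x = 0" if "inner x y = 0" for x y :: 'r
    using that by (simp add: inner_commute)
qed (auto simp: inner_add_left dot_square_norm)

text \<open>Continuity of \<open>ip\<close> is the substantial point; polarization derives it from
  continuity of the norm.\<close>

lemma (in complex_hilbert_space) scalar_inner_product_complex:
  "scalar_inner_product smul ip Re"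
proof (intro scalar_inner_product.intro scalar_inner_product_axioms.intro)
  show "vector_space smul"
    by (rule vector_space_axioms)
  have add_right: "ip z (x + y) = ip z x + ip z y" for x y z
    using ip_add_left[of x y z] ip_cnj[of "x + y" z] ip_cnj[of x z] ip_cnj[of y z]
    by (metis complex_cnj_add ip_cnj)
  have Re_commute: "Re (ip y x) = Re (ip x y)" for x y
    using ip_cnj[of y x] by simp
  show sq: "(norm (x + y))\<^sup>2 = (norm x)\<^sup>2 + 2 * Re (ip x y) + (norm y)\<^sup>2" for x y
  proof -
    have "(norm z)\<^sup>2 = Re (ip z z)" for z
      by (simp add: ip_self)
    then show ?thesis
      using Re_commute[of x y] by (simp add: ip_add_left add_right)
  qed
  have Re_cont: "continuous_on UNIV (\<lambda>x. Re (ip x y))" for y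
  proof -
    have "Re (ip x y) = ((norm (x + y))\<^sup>2 - (norm x)\<^sup>2 - (norm y)\<^sup>2) / 2" for x
      using sq[of x y] by simp
    then show ?thesis
      by (simp only:) (intro continuous_intros, simp)
  qed
  \<comment> \<open>The imaginary part of \<open>ip x y\<close> is the real part of
    \<open>ip x (smul \<i> y)\<close>, so continuity of real parts suffices.\<close>
  have "ip x (smul \<i> y) = - \<i> * ip x y" for x y
    using ip_scale_left[of \<i> y x] ip_cnj[of "smul \<i> y" x] ip_cnj[of y x]
    by (metis complex_cnj_i complex_cnj_mult ip_cnj)
  then have "ip x y = Complex (Re (ip x y)) (Re (ip x (smul \<i> y)))" for x y
    by (simp add: complex_eq_iff)
  then have "(\<lambda>x. ip x y) = (\<lambda>x. Complex (Re (ip x y)) (Re (ip x (smul \<i> y))))" for y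
    by (rule ext)
  moreover have "continuous_on UNIV (\<lambda>x. Complex (Re (ip x y)) (Re (ip x (smul \<i> y))))" for y
    unfolding Complex_eq
    by (intro continuous_on_add continuous_on_mult continuous_on_of_real continuous_on_const Re_cont)
  ultimately show "continuous_on UNIV (\<lambda>x. ip x y)" for y
    by (simp only:)
  show "ip y x = 0" if "ip x y = 0" for x y
    using ip_cnj[of y x] that by simp
  show "linear Re"
    by (simp add: bounded_linear.linear bounded_linear_Re)
qed (auto simp: ip_add_left ip_scale_left ip_self scale_of_real)

theorem theorem2p3:
  fixes scaleC :: "complex \<Rightarrow> 'c::banach \<Rightarrow> 'c"
    and ip :: "'c \<Rightarrow> 'c \<Rightarrow> complex"
  shows "(\<not> fin_dim scaleR (UNIV :: 'r::{real_inner, complete_space} set) \<longrightarrow>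
            (\<forall>n::nat\<ge>1. covering_index (scaleR :: real \<Rightarrow> 'r \<Rightarrow> 'r) n = ennreal (real n powr (-1/2))) \<and>
            covering_index (scaleR :: real \<Rightarrow> 'r \<Rightarrow> 'r) 2 = ennreal (1 / sqrt 2))
       \<and> (complex_hilbert_space scaleC ip \<and> \<not> fin_dim scaleC (UNIV :: 'c set) \<longrightarrow>
            (\<forall>n::nat\<ge>1. covering_index scaleC n = ennreal (real n powr (-1/2))) \<and>
            covering_index scaleC 2 = ennreal (1 / sqrt 2))"
proof -
  have two: "real 2 powr (-1/2) = 1 / sqrt 2"
    by (simp add: powr_minus_divide powr_half_sqrt)
  show ?thesis
    using scalar_inner_product.covering_index_eq[OF scalar_inner_product_real]
      scalar_inner_product.covering_index_eq[OF complex_hilbert_space.scalar_inner_product_complex]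
    by (metis two one_le_numeral)
qed

end
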